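(* Let $\gamma\in\mathbb N\setminus\{1\}$, $b_1<b_2<\dots<b_\gamma$ real numbers, and $a\in C(\mathbb R,\mathbb R)$ with $a(x)=(\max\{x,0\})^\gamma$ for all $x\in\mathbb R$. Then (i) $(\mathcal R_a(\mathbf I_\gamma))(x)=x^\gamma$ for all $x\in\mathbb R$; (ii) there exist unique $c_0,\dots,c_\gamma\in\mathbb R$ such that for all $k\in\{0,1,\dots,\gamma\}$, $\mathbb 1_{\{\gamma\}}(k)c_0+\sum_{i=1}^\gamma c_i(b_i)^k=\mathbb 1_{\{\gamma-1\}}(k)\gamma^{-1}$; (iii) with these constants $\Psi=\mathbf A_{1,c_0}\bullet\bigl(\bigoplus_{i=1}^\gamma(c_i\circledast(\mathbf I_\gamma\bullet\mathbf A_{1,b_i}))\bigr)\in\mathbf N$ is well defined; (iv) $\mathcal D(\Psi)=(1,2\gamma,1)$; (v) $\mathcal R_a(\Psi)\in C(\mathbb R,\mathbb R)$; and (vi) $(\mathcal R_a(\Psi))(x)=x$ for all $x\in\mathbb R$.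
   Context: Artificial neural networks (ANNs). Let $\mathbb N=\{1,2,\dots\}$ and $\mathbf N=\bigcup_{L\in\mathbb N}\bigcup_{l_0,\dots,l_L\in\mathbb N}\prod_{k=1}^L(\mathbb R^{l_k\times l_{k-1}}\times\mathbb R^{l_k})$. For $\Phi=((W_1,B_1),\dots,(W_L,B_L))$ in the $(l_0,\dots,l_L)$ component, $\mathcal L(\Phi)=L$, $\mathcal I(\Phi)=l_0$, $\mathcal O(\Phi)=l_L$, $\mathcal D(\Phi)=(l_0,\dots,l_L)$. For $a\in C(\mathbb R,\mathbb R)$ the realization is $(\mathcal R_a(\Phi))(x_0)=W_Lx_{L-1}+B_L$ with $x_k=\mathfrak M_{a,l_k}(W_kx_{k-1}+B_k)$, $k=1,\dots,L-1$, $\mathfrak M_{a,m}$ applying $a$ componentwise. $\operatorname I_n$ is the identity matrix; $\mathbf A_{W,B}=((W,B))$ (for reals $w,b$, $\mathbf A_{w,b}$ has $1\times1$ weight $w$ and bias $b$). Composition: for $\Phi_1=((W_1,B_1),\dots,(W_L,B_L))$, $\Phi_2=((\mathscr W_1,\mathscr B_1),\dots,(\mathscr W_{\mathfrak L},\mathscr B_{\mathfrak L}))$ with $\mathcal I(\Phi_1)=\mathcal O(\Phi_2)$, $\Phi_1\bullet\Phi_2=((\mathscr W_1,\mathscr B_1),\dots,(\mathscr W_{\mathfrak L-1},\mathscr B_{\mathfrak L-1}),(W_1\mathscr W_{\mathfrak L},W_1\mathscr B_{\mathfrak L}+B_1),(W_2,B_2),\dots,(W_L,B_L))$. $\lambda\circledast\Phi=\mathbf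 A_{\lambda\operatorname I_{\mathcal O(\Phi)},0}\bullet\Phi$. $\mathbf P_n(\Phi_1,\dots,\Phi_n)$ (equal lengths) has $k$-th layer $(\operatorname{diag}(W_{1,k},\dots,W_{n,k}),(B_{1,k},\dots,B_{n,k}))$. $\mathfrak S_{m,n}=\mathbf A_{(\operatorname I_m\cdots\operatorname I_m),0}$, $\mathfrak T_{m,n}=\mathbf A_{(\operatorname I_m\cdots\operatorname I_m)^\top,0}$ ($n$ blocks). For $\Phi_u,\dots,\Phi_v$ with equal $\mathcal L,\mathcal I,\mathcal O$: $\bigoplus_{k=u}^v\Phi_k=\mathfrak S_{\mathcal O(\Phi_u),v-u+1}\bullet([\mathbf P_{v-u+1}(\Phi_u,\dots,\Phi_v)]\bullet\mathfrak T_{\mathcal I(\Phi_u),v-u+1})$. For $\gamma\in\mathbb N_0$, $\mathbf I_\gamma=\bigl(\bigl(\begin{pmatrix}1\\-1\end{pmatrix},\begin{pmatrix}0\\0\end{pmatrix}\bigr),\bigl(\begin{pmatrix}1&(-1)^\gamma\end{pmatrix},0\bigr)\bigr)\in(\mathbb R^{2\times1}\times\mathbb R^2)\times(\mathbb R^{1\times2}\times\mathbb R^1)$. *)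

theory Defs
  imports Complex_Main "Jordan_Normal_Form.Matrix"
begin

text \<open>An ANN is a list of layers (W_k, B_k); real matrices/vectors from Jordan_Normal_Form.\<close>
type_synonym ann = "(real mat \<times> real vec) list"

definition ann_dims :: "ann \<Rightarrow> nat list" where
  "ann_dims \<Phi> = dim_col (fst (hd \<Phi>)) # map (\<lambda>l. dim_row (fst l)) \<Phi>"

definition ann_len :: "ann \<Rightarrow> nat" where "ann_len \<Phi> = length \<Phi>"
definition ann_in :: "ann \<Rightarrow> nat" where "ann_in \<Phi> = dim_col (fst (hd \<Phi>))"
definition ann_out :: "ann \<Rightarrow> nat" where "ann_out \<Phi> = dim_row (fst (last \<Phi>))"

text \<open>Membership in the set \<open>\<bold>N\<close> of ANNs (all layer dimensions in {1,2,...}).\<close>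
definition is_ann :: "ann \<Rightarrow> bool" where
  "is_ann \<Phi> \<longleftrightarrow> \<Phi> \<noteq> [] \<and>
     (\<forall>k < length \<Phi>. dim_vec (snd (\<Phi> ! k)) = dim_row (fst (\<Phi> ! k))) \<and>
     (\<forall>k. Suc k < length \<Phi> \<longrightarrow> dim_col (fst (\<Phi> ! Suc k)) = dim_row (fst (\<Phi> ! k))) \<and>
     (\<forall>d \<in> set (ann_dims \<Phi>). 1 \<le> d)"

text \<open>Realization: activation applied componentwise after all but the last layer.\<close>
fun realize :: "(real \<Rightarrow> real) \<Rightarrow> ann \<Rightarrow> real vec \<Rightarrow> real vec" where
  "realize a [] x = x"
| "realize a [(W, B)] x = mult_mat_vec W x + B"
| "realize a ((W, B) # l # ls) x = realize a (l # ls) (map_vec a (mult_mat_vec W x + B))"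

definition affine_ann :: "real mat \<Rightarrow> real vec \<Rightarrow> ann" where
  "affine_ann W B = [(W, B)]"

definition affine1 :: "real \<Rightarrow> real \<Rightarrow> ann" where
  "affine1 w b = affine_ann (mat 1 1 (\<lambda>_. w)) (vec 1 (\<lambda>_. b))"

text \<open>Composition \<open>\<Phi>1 \<bullet> \<Phi>2\<close>.\<close>
definition comp_ann :: "ann \<Rightarrow> ann \<Rightarrow> ann" where
  "comp_ann \<Phi>1 \<Phi>2 =
     butlast \<Phi>2 @
     [(fst (hd \<Phi>1) * fst (last \<Phi>2), mult_mat_vec (fst (hd \<Phi>1)) (snd (last \<Phi>2)) + snd (hd \<Phi>1))]
     @ tl \<Phi>1"

definition scal_ann :: "real \<Rightarrow> ann \<Rightarrow> ann" where
  "scal_ann r \<Phi> = comp_ann (affine_ann (r \<cdot>\<^sub>m 1\<^sub>m (ann_out \<Phi>)) (0\<^sub>v (ann_out \<Phi>))) \<Phi>"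

fun blockdiag :: "real mat list \<Rightarrow> real mat" where
  "blockdiag [] = 0\<^sub>m 0 0"
| "blockdiag (M # Ms) = four_block_mat M (0\<^sub>m (dim_row M) (dim_col (blockdiag Ms)))
                          (0\<^sub>m (dim_row (blockdiag Ms)) (dim_col M)) (blockdiag Ms)"

fun vconcat :: "real vec list \<Rightarrow> real vec" where
  "vconcat [] = 0\<^sub>v 0"
| "vconcat (v # vs) = v @\<^sub>v vconcat vs"

text \<open>Parallelization \<open>\<bold>P\<^sub>n(\<Phi>_1,...,\<Phi>_n)\<close> of networks of equal length.\<close>
definition par_ann :: "ann list \<Rightarrow> ann" where
  "par_ann \<Phi>s = map (\<lambda>k. (blockdiag (map (\<lambda>\<Phi>. fst (\<Phi> ! k)) \<Phi>s),
                           vconcat (map (\<lambda>\<Phi>. snd (\<Phi> ! k)) \<Phi>s)))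
                  [0..<length (hd \<Phi>s)]"

text \<open>\<open>\<frak>S_{m,n}\<close> = A with (I_m ... I_m), \<open>\<frak>T_{m,n}\<close> = A with its transpose.\<close>
definition sum_ann :: "nat \<Rightarrow> nat \<Rightarrow> ann" where
  "sum_ann m n = affine_ann (mat m (m * n) (\<lambda>(i, j). if i = j mod m then 1 else 0)) (0\<^sub>v m)"

definition trans_ann :: "nat \<Rightarrow> nat \<Rightarrow> ann" where
  "trans_ann m n = affine_ann (mat (m * n) m (\<lambda>(i, j). if j = i mod m then 1 else 0)) (0\<^sub>v (m * n))"

text \<open>Sum of networks \<open>\<Phi>_u \<oplus> ... \<oplus> \<Phi>_v\<close> (given as nonempty list).\<close>
definition osum_ann :: "ann list \<Rightarrow> ann" where
  "osum_ann \<Phi>s = comp_ann (sum_ann (ann_out (hd \<Phi>s)) (length \<Phi>s))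
                   (comp_ann (par_ann \<Phi>s) (trans_ann (ann_in (hd \<Phi>s)) (length \<Phi>s)))"

text \<open>The network \<open>\<bold>I\<^sub>\<gamma>\<close>.\<close>
definition I_ann :: "nat \<Rightarrow> ann" where
  "I_ann \<gamma> = [(mat 2 1 (\<lambda>(i, j). if i = 0 then 1 else -1), 0\<^sub>v 2),
              (mat 1 2 (\<lambda>(i, j). if j = 0 then 1 else (-1) ^ \<gamma>), 0\<^sub>v 1)]"

text \<open>The network \<open>\<Psi>\<close> built from constants c_0..c_\<gamma> (list c of length \<gamma>+1) and b_1..b_\<gamma>.\<close>
definition Psi_ann :: "nat \<Rightarrow> (nat \<Rightarrow> real) \<Rightarrow> real list \<Rightarrow> ann" where
  "Psi_ann \<gamma> b c = comp_ann (affine1 1 (c ! 0))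
      (osum_ann (map (\<lambda>i. scal_ann (c ! i) (comp_ann (I_ann \<gamma>) (affine1 1 (b i)))) [1..<\<gamma>+1]))"

end

theory Submission
  imports Defs "HOL-Computational_Algebra.Polynomial" "Jordan_Normal_Form.Determinant"
begin

text \<open>
  For \<open>a = max(\<cdot>, 0)^\<gamma>\<close> one has \<open>a(y) + (-1)^\<gamma> a(-y) = y^\<gamma>\<close>, so \<open>\<bold>I\<^sub>\<gamma>\<close> realizes
  \<open>x^\<gamma>\<close> and \<open>\<Psi>\<close>, an affine map after a sum of \<open>\<gamma>\<close> shifted and scaled copies of
  \<open>\<bold>I\<^sub>\<gamma>\<close>, realizes \<open>c\<^sub>0 + \<Sum>\<^sub>i c\<^sub>i (x + b\<^sub>i)^\<gamma>\<close>. Expanding binomially, the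
  coefficient of \<open>x^(\<gamma>-k)\<close> is \<open>(\<gamma> choose k) \<Sum>\<^sub>i c\<^sub>i b\<^sub>i^k\<close>; the conditions on \<open>c\<close> make
  all of them vanish except that of \<open>x\<close>, which becomes \<open>1\<close>, and let \<open>c\<^sub>0\<close> cancel the
  constant term. These conditions form a Vandermonde system in \<open>c\<^sub>1, \<dots>, c\<^sub>\<gamma>\<close>, uniquely
  solvable because the \<open>b\<^sub>i\<close> are distinct.
\<close>

section \<open>Block vectors and block-diagonal matrices\<close>

lemma vconcat_carrier_vec:
  "\<forall>v\<in>set vs. v \<in> carrier_vec r \<Longrightarrow> vconcat vs \<in> carrier_vec (length vs * r)"
  by (induct vs) auto

lemma index_vconcat:
  assumes "\<forall>v\<in>set vs. v \<in> carrier_vec r" and "i < length vs * r"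
  shows "vconcat vs $ i = (vs ! (i div r)) $ (i mod r)"
  using assms
proof (induct vs arbitrary: i)
  case (Cons v vs)
  have v: "dim_vec v = r" and vs: "dim_vec (vconcat vs) = length vs * r"
    using Cons.prems(1) vconcat_carrier_vec[of vs r] by auto
  have r: "0 < r"
    using Cons.prems(2) by (cases r) auto
  show ?case
  proof (cases "i < r")
    case True
    then show ?thesis
      using v vs by simp
  next
    case False
    have "(v @\<^sub>v vconcat vs) $ i = vconcat vs $ (i - r)"
      using index_append_vec(1)[of i v "vconcat vs"] False v vs Cons.prems(2) by simp
    also have "\<dots> = vs ! ((i - r) div r) $ ((i - r) mod r)"
      using Cons False by auto
    also have "\<dots> = (v # vs) ! (i div r) $ (i mod r)"
      using False r by (simp add: le_div_geq le_mod_geq)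
    finally show ?thesis
      by simp
  qed
qed simp

lemma map_vec_vconcat: "map_vec f (vconcat vs) = vconcat (map (map_vec f) vs)"
proof -
  have "map_vec f (v @\<^sub>v w) = map_vec f v @\<^sub>v map_vec f w" for v w :: "real vec"
    by (intro eq_vecI) auto
  then show ?thesis
    by (induct vs) auto
qed

lemma vconcat_add:
  "list_all2 (\<lambda>v w. dim_vec v = dim_vec w) vs ws \<Longrightarrow>
    vconcat vs + vconcat ws = vconcat (map2 (+) vs ws)"
proof (induct vs ws rule: list_all2_induct)
  case (Cons v vs w ws)
  have "dim_vec (vconcat vs) = dim_vec (vconcat ws)"
    using Cons.hyps(2) by (induct rule: list_all2_induct) simp_all
  then have "v \<in> carrier_vec (dim_vec w)" "w \<in> carrier_vec (dim_vec w)"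
    "vconcat vs \<in> carrier_vec (dim_vec (vconcat ws))" "vconcat ws \<in> carrier_vec (dim_vec (vconcat ws))"
    using Cons.hyps(1) by (auto intro: carrier_vecI)
  then have "vconcat (v # vs) + vconcat (w # ws) = (v + w) @\<^sub>v (vconcat vs + vconcat ws)"
    unfolding vconcat.simps by (rule append_vec_add)
  with Cons.hyps(3) show ?case
    by simp
qed (rule eq_vecI; simp)

lemma blockdiag_carrier_mat:
  "\<forall>M\<in>set Ms. M \<in> carrier_mat r s \<Longrightarrow>
    blockdiag Ms \<in> carrier_mat (length Ms * r) (length Ms * s)"
proof (induct Ms)
  case (Cons M Ms)
  then have "M \<in> carrier_mat r s" "blockdiag Ms \<in> carrier_mat (length Ms * r) (length Ms * s)"
    by auto
  then show ?case
    using four_block_carrier_mat by simp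
qed simp

lemma blockdiag_mult_vconcat:
  "list_all2 (\<lambda>M v. M \<in> carrier_mat r s \<and> v \<in> carrier_vec s) Ms vs \<Longrightarrow>
    blockdiag Ms *\<^sub>v vconcat vs = vconcat (map2 (*\<^sub>v) Ms vs)"
proof (induct Ms vs rule: list_all2_induct)
  case (Cons M Ms v vs)
  have Ms: "blockdiag Ms \<in> carrier_mat (length Ms * r) (length Ms * s)"
    and vs: "vconcat vs \<in> carrier_vec (length Ms * s)"
    using Cons.hyps(2) by (induct Ms vs rule: list_all2_induct) auto
  have M: "M \<in> carrier_mat r s" and v: "v \<in> carrier_vec s"
    using Cons.hyps(1) by auto
  have zero: "0\<^sub>m n m *\<^sub>v w = 0\<^sub>v n" if "w \<in> carrier_vec m" for n m and w :: "real vec"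
    using that by (intro eq_vecI) (auto simp: scalar_prod_def)
  have "blockdiag (M # Ms) *\<^sub>v vconcat (v # vs)
      = (M *\<^sub>v v + 0\<^sub>m r (length Ms * s) *\<^sub>v vconcat vs) @\<^sub>v
        (0\<^sub>m (length Ms * r) s *\<^sub>v v + blockdiag Ms *\<^sub>v vconcat vs)"
    using M Ms v vs by (simp add: four_block_mat_mult_vec[OF M _ _ Ms v vs])
  also have "\<dots> = M *\<^sub>v v @\<^sub>v blockdiag Ms *\<^sub>v vconcat vs"
    using M Ms v vs by (simp add: zero)
  finally show ?case
    using Cons.hyps(3) by simp
qed (auto intro!: eq_vecI)

text \<open>The weight matrices of \<open>\<frak>S\<^sub>m\<^sub>,\<^sub>n = sum_ann m n\<close> and \<open>\<frak>T\<^sub>m\<^sub>,\<^sub>n = trans_ann m n\<close>.\<close>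

definition block_sum_mat :: "nat \<Rightarrow> nat \<Rightarrow> real mat" where
  "block_sum_mat m n = mat m (m * n) (\<lambda>(i, j). if i = j mod m then 1 else 0)"

definition block_copy_mat :: "nat \<Rightarrow> nat \<Rightarrow> real mat" where
  "block_copy_mat m n = mat (m * n) m (\<lambda>(i, j). if j = i mod m then 1 else 0)"

lemma block_copy_mat_carrier: "block_copy_mat m n \<in> carrier_mat (n * m) m"
  and block_sum_mat_carrier: "block_sum_mat m n \<in> carrier_mat m (n * m)"
  by (simp_all add: block_copy_mat_def block_sum_mat_def mult.commute)

lemma block_copy_mat_mult_vec:
  assumes "x \<in> carrier_vec m"
  shows "block_copy_mat m n *\<^sub>v x = vconcat (replicate n x)"
proof (rule eq_vecI)
  have dim: "dim_vec (vconcat (replicate n x)) = m * n"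
    using vconcat_carrier_vec[of "replicate n x" m] assms by auto
  then show "dim_vec (block_copy_mat m n *\<^sub>v x) = dim_vec (vconcat (replicate n x))"
    by (simp add: block_copy_mat_def)
  fix i assume "i < dim_vec (vconcat (replicate n x))"
  then have i: "i < n * m"
    using dim by (simp add: mult.commute)
  then have "0 < m"
    by (cases m) auto
  have "(block_copy_mat m n *\<^sub>v x) $ i = (\<Sum>j<m. if j = i mod m then x $ j else 0)"
    using i assms by (simp add: block_copy_mat_def scalar_prod_def atLeast0LessThan mult.commute[of m]
        if_distrib[of "\<lambda>c. c * _"] cong: if_cong)
  also have "\<dots> = x $ (i mod m)"
    using \<open>0 < m\<close> by simp
  also have "\<dots> = replicate n x ! (i div m) $ (i mod m)"
    using i by (simp add: less_mult_imp_div_less)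
  also have "\<dots> = vconcat (replicate n x) $ i"
    by (rule index_vconcat[symmetric]) (use i assms in auto)
  finally show "(block_copy_mat m n *\<^sub>v x) $ i = vconcat (replicate n x) $ i" .
qed

lemma block_sum_mat_mult_vconcat:
  assumes vs: "\<forall>v\<in>set vs. v \<in> carrier_vec m" and n: "length vs = n"
  shows "block_sum_mat m n *\<^sub>v vconcat vs = vec m (\<lambda>i. \<Sum>k<n. vs ! k $ i)"
proof (rule eq_vecI)
  show "dim_vec (block_sum_mat m n *\<^sub>v vconcat vs) = dim_vec (vec m (\<lambda>i. \<Sum>k<n. vs ! k $ i))"
    by (simp add: block_sum_mat_def)
  fix i assume "i < dim_vec (vec m (\<lambda>i. \<Sum>k<n. vs ! k $ i))"
  then have i: "i < m"
    by simp
  have dim: "dim_vec (vconcat vs) = n * m"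
    using vconcat_carrier_vec[of vs m] vs n by auto
  have "(block_sum_mat m n *\<^sub>v vconcat vs) $ i
      = (\<Sum>j<n * m. if i = j mod m then vs ! (j div m) $ (j mod m) else 0)"
    using i dim vs n
    by (simp add: block_sum_mat_def scalar_prod_def index_vconcat[of _ m] atLeast0LessThan mult.commute[of m]
        if_distrib[of "\<lambda>c. c * _"] cong: if_cong)
  also have "\<dots> = (\<Sum>k<n. \<Sum>j\<in>{k * m..<k * m + m}. if j = k * m + i then vs ! k $ i else 0)"
  proof (subst sum.nat_group[symmetric], intro sum.cong refl)
    fix k j assume "j \<in> {k * m..<k * m + m}"
    then obtain r where j: "j = k * m + r" and "r < m"
      by (metis atLeastLessThan_iff le_add_diff_inverse nat_add_left_cancel_less)
    then show "(if i = j mod m then vs ! (j div m) $ (j mod m) else 0)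
        = (if j = k * m + i then vs ! k $ i else 0)"
      by auto
  qed
  also have "\<dots> = (\<Sum>k<n. vs ! k $ i)"
    using i by simp
  finally show "(block_sum_mat m n *\<^sub>v vconcat vs) $ i = vec m (\<lambda>i. \<Sum>k<n. vs ! k $ i) $ i"
    using i by simp
qed

section \<open>Two-layer networks and their sums\<close>

lemma is_ann_two_layer:
  assumes "W \<in> carrier_mat h p" "B \<in> carrier_vec h" "V \<in> carrier_mat m h" "C \<in> carrier_vec m"
    and "0 < p" "0 < h" "0 < m"
  shows "is_ann [(W, B), (V, C)]" and "ann_dims [(W, B), (V, C)] = [p, h, m]"
  using assms by (auto simp: is_ann_def ann_dims_def less_Suc_eq numeral_2_eq_2)

lemma realize_comp_affine_ann_two_layer:
  assumes V: "V \<in> carrier_mat m h" and C: "C \<in> carrier_vec m" and B: "B \<in> carrier_vec h"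
    and M: "M \<in> carrier_mat q m" and v: "v \<in> carrier_vec q"
  shows "realize a (comp_ann (affine_ann M v) [(W, B), (V, C)]) x
    = M *\<^sub>v realize a [(W, B), (V, C)] x + v"
proof -
  let ?y = "map_vec a (W *\<^sub>v x + B)"
  have y: "?y \<in> carrier_vec h"
    using carrier_vecD[OF B] by (intro carrier_vecI) simp
  have "realize a (comp_ann (affine_ann M v) [(W, B), (V, C)]) x = (M * V) *\<^sub>v ?y + (M *\<^sub>v C + v)"
    by (simp add: comp_ann_def affine_ann_def del: assoc_mult_mat_vec)
  also have "\<dots> = M *\<^sub>v (V *\<^sub>v ?y + C) + v"
    unfolding assoc_mult_mat_vec[OF M V y] mult_add_distrib_mat_vec[OF M mult_mat_vec_carrier[OF V y] C]
    using M V C v y by (intro assoc_add_vec[of _ q, symmetric]) (auto simp del: assoc_mult_mat_vec)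
  finally show ?thesis
    by simp
qed

locale two_layer_family =
  fixes n p h m :: nat and W V :: "nat \<Rightarrow> real mat" and B C :: "nat \<Rightarrow> real vec"
  assumes n_pos: "0 < n"
    and carrier_W: "\<And>k. k < n \<Longrightarrow> W k \<in> carrier_mat h p"
    and carrier_B: "\<And>k. k < n \<Longrightarrow> B k \<in> carrier_vec h"
    and carrier_V: "\<And>k. k < n \<Longrightarrow> V k \<in> carrier_mat m h"
    and carrier_C: "\<And>k. k < n \<Longrightarrow> C k \<in> carrier_vec m"
begin

abbreviation net :: "nat \<Rightarrow> ann" where
  "net k \<equiv> [(W k, B k), (V k, C k)]"

lemma osum_ann_eq:
  "osum_ann (map net [0..<n]) =
    [(blockdiag (map W [0..<n]) * block_copy_mat p n,
      blockdiag (map W [0..<n]) *\<^sub>v 0\<^sub>v (p * n) + vconcat (map B [0..<n])),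
     (block_sum_mat m n * blockdiag (map V [0..<n]),
      block_sum_mat m n *\<^sub>v vconcat (map C [0..<n]) + 0\<^sub>v m)]"
proof -
  have hd: "hd (map net [0..<n]) = net 0"
    using n_pos by (simp add: hd_map)
  have dims: "ann_in (net 0) = p" "ann_out (net 0) = m"
    using carrier_W[OF n_pos] carrier_V[OF n_pos] by (auto simp: ann_in_def ann_out_def)
  have "[0..<length (net 0)] = [0, 1]"
    by (simp add: upt_rec)
  then have par: "par_ann (map net [0..<n]) =
      [(blockdiag (map W [0..<n]), vconcat (map B [0..<n])),
       (blockdiag (map V [0..<n]), vconcat (map C [0..<n]))]"
    unfolding par_ann_def hd by (simp add: o_def del: blockdiag.simps vconcat.simps)
  show ?thesis
    unfolding osum_ann_def hd dims par
    by (simp add: comp_ann_def sum_ann_def trans_ann_def affine_ann_def block_sum_mat_def block_copy_mat_def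
        del: blockdiag.simps vconcat.simps)
qed

lemma blockdiag_W_carrier: "blockdiag (map W [0..<n]) \<in> carrier_mat (n * h) (n * p)"
  using blockdiag_carrier_mat[of "map W [0..<n]" h p] carrier_W by auto

lemma blockdiag_V_carrier: "blockdiag (map V [0..<n]) \<in> carrier_mat (n * m) (n * h)"
  using blockdiag_carrier_mat[of "map V [0..<n]" m h] carrier_V by auto

lemma vconcat_B_carrier: "vconcat (map B [0..<n]) \<in> carrier_vec (n * h)"
  using vconcat_carrier_vec[of "map B [0..<n]" h] carrier_B by auto

lemma vconcat_C_carrier: "vconcat (map C [0..<n]) \<in> carrier_vec (n * m)"
  using vconcat_carrier_vec[of "map C [0..<n]" m] carrier_C by auto

lemma realize_osum_ann:
  assumes x: "x \<in> carrier_vec p"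
  shows "realize a (osum_ann (map net [0..<n])) x = vec m (\<lambda>i. \<Sum>k<n. realize a (net k) x $ i)"
proof -
  let ?BW = "blockdiag (map W [0..<n])" and ?BV = "blockdiag (map V [0..<n])"
  let ?y = "\<lambda>k. map_vec a (W k *\<^sub>v x + B k)"
  have zero: "?BW *\<^sub>v 0\<^sub>v (p * n) = 0\<^sub>v (n * h)"
    using blockdiag_W_carrier by (intro eq_vecI) (auto simp: scalar_prod_def)
  have "?BW * block_copy_mat p n *\<^sub>v x = ?BW *\<^sub>v vconcat (map (\<lambda>k. x) [0..<n])"
    by (simp add: assoc_mult_mat_vec[OF blockdiag_W_carrier block_copy_mat_carrier x]
        block_copy_mat_mult_vec[OF x] map_replicate_const)
  also have "\<dots> = vconcat (map (\<lambda>k. W k *\<^sub>v x) [0..<n])"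
    using carrier_W x
    by (simp add: blockdiag_mult_vconcat[of h p] list_all2_map1 list_all2_map2 list_all2_same map2_map_map)
  finally have first_layer:
    "?BW * block_copy_mat p n *\<^sub>v x = vconcat (map (\<lambda>k. W k *\<^sub>v x) [0..<n])" .
  have dims_WB: "dim_row (W k) = h" "dim_vec (B k) = h" if "k < n" for k
    using carrier_W[OF that] carrier_B[OF that] by auto
  have hidden: "map_vec a (?BW * block_copy_mat p n *\<^sub>v x + (?BW *\<^sub>v 0\<^sub>v (p * n)
      + vconcat (map B [0..<n]))) = vconcat (map ?y [0..<n])"
    using first_layer dims_WB vconcat_B_carrier
    by (simp add: zero vconcat_add list_all2_map1 list_all2_map2 list_all2_same map2_map_map
        map_vec_vconcat o_def)
  have y: "?y k \<in> carrier_vec h" if "k < n" for k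
    using carrier_vecD[OF carrier_B[OF that]] by (intro carrier_vecI) simp
  have out: "realize a (net k) x \<in> carrier_vec m" if "k < n" for k
    using carrier_V[OF that] carrier_C[OF that] y[OF that] by simp
  have dims_VC: "dim_row (V k) = m" "dim_vec (C k) = m" if "k < n" for k
    using carrier_V[OF that] carrier_C[OF that] by auto
  have Y: "vconcat (map ?y [0..<n]) \<in> carrier_vec (n * h)"
    using vconcat_carrier_vec[of "map ?y [0..<n]" h] y by auto
  have VY: "?BV *\<^sub>v vconcat (map ?y [0..<n]) = vconcat (map (\<lambda>k. V k *\<^sub>v ?y k) [0..<n])"
    using carrier_V y
    by (simp add: blockdiag_mult_vconcat[of m h] list_all2_map1 list_all2_map2 list_all2_same map2_map_map)
  have "block_sum_mat m n * ?BV *\<^sub>v vconcat (map ?y [0..<n])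
      + (block_sum_mat m n *\<^sub>v vconcat (map C [0..<n]) + 0\<^sub>v m)
      = block_sum_mat m n *\<^sub>v (?BV *\<^sub>v vconcat (map ?y [0..<n]))
        + block_sum_mat m n *\<^sub>v vconcat (map C [0..<n])"
    using block_sum_mat_carrier[of m n] blockdiag_V_carrier Y vconcat_C_carrier by simp
  also have "\<dots> = block_sum_mat m n *\<^sub>v
      (vconcat (map (\<lambda>k. V k *\<^sub>v ?y k) [0..<n]) + vconcat (map C [0..<n]))"
    unfolding VY using blockdiag_V_carrier Y vconcat_C_carrier
    by (intro mult_add_distrib_mat_vec[symmetric, OF block_sum_mat_carrier]) (auto simp flip: VY)
  also have "\<dots> = block_sum_mat m n *\<^sub>v vconcat (map (\<lambda>k. realize a (net k) x) [0..<n])"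
    using dims_VC by (simp add: vconcat_add list_all2_map1 list_all2_map2 list_all2_same map2_map_map)
  also have "\<dots> = vec m (\<lambda>i. \<Sum>k<n. realize a (net k) x $ i)"
    using out by (subst block_sum_mat_mult_vconcat) auto
  finally show ?thesis
    unfolding osum_ann_eq by (simp add: hidden)
qed

lemma osum_ann_layer_carrier:
  "blockdiag (map W [0..<n]) * block_copy_mat p n \<in> carrier_mat (n * h) p"
  "blockdiag (map W [0..<n]) *\<^sub>v 0\<^sub>v (p * n) + vconcat (map B [0..<n]) \<in> carrier_vec (n * h)"
  "block_sum_mat m n * blockdiag (map V [0..<n]) \<in> carrier_mat m (n * h)"
  "block_sum_mat m n *\<^sub>v vconcat (map C [0..<n]) + 0\<^sub>v m \<in> carrier_vec m"
proof -
  have "0\<^sub>v (p * n) \<in> carrier_vec (n * p)"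
    by (simp add: mult.commute)
  then show "blockdiag (map W [0..<n]) *\<^sub>v 0\<^sub>v (p * n) + vconcat (map B [0..<n]) \<in> carrier_vec (n * h)"
    by (intro add_carrier_vec mult_mat_vec_carrier[OF blockdiag_W_carrier] vconcat_B_carrier)
  show "blockdiag (map W [0..<n]) * block_copy_mat p n \<in> carrier_mat (n * h) p"
    by (rule mult_carrier_mat[OF blockdiag_W_carrier block_copy_mat_carrier])
  show "block_sum_mat m n * blockdiag (map V [0..<n]) \<in> carrier_mat m (n * h)"
    by (rule mult_carrier_mat[OF block_sum_mat_carrier blockdiag_V_carrier])
  show "block_sum_mat m n *\<^sub>v vconcat (map C [0..<n]) + 0\<^sub>v m \<in> carrier_vec m"
    by (intro add_carrier_vec mult_mat_vec_carrier[OF block_sum_mat_carrier vconcat_C_carrier] zero_carrier_vec)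
qed

lemma is_ann_comp_affine_osum_ann:
  assumes M: "M \<in> carrier_mat q m" and v: "v \<in> carrier_vec q" and "0 < p" "0 < h" "0 < q"
  shows "is_ann (comp_ann (affine_ann M v) (osum_ann (map net [0..<n])))"
    and "ann_dims (comp_ann (affine_ann M v) (osum_ann (map net [0..<n]))) = [p, n * h, q]"
proof -
  have "comp_ann (affine_ann M v) (osum_ann (map net [0..<n])) =
    [(blockdiag (map W [0..<n]) * block_copy_mat p n,
      blockdiag (map W [0..<n]) *\<^sub>v 0\<^sub>v (p * n) + vconcat (map B [0..<n])),
     (M * (block_sum_mat m n * blockdiag (map V [0..<n])),
      M *\<^sub>v (block_sum_mat m n *\<^sub>v vconcat (map C [0..<n]) + 0\<^sub>v m) + v)]"
    unfolding osum_ann_eq by (simp add: comp_ann_def affine_ann_def del: assoc_mult_mat_vec)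
  moreover have "M * (block_sum_mat m n * blockdiag (map V [0..<n])) \<in> carrier_mat q (n * h)"
    by (rule mult_carrier_mat[OF M osum_ann_layer_carrier(3)])
  moreover have "M *\<^sub>v (block_sum_mat m n *\<^sub>v vconcat (map C [0..<n]) + 0\<^sub>v m) + v \<in> carrier_vec q"
    by (intro add_carrier_vec mult_mat_vec_carrier[OF M osum_ann_layer_carrier(4)] v)
  ultimately show "is_ann (comp_ann (affine_ann M v) (osum_ann (map net [0..<n])))"
    and "ann_dims (comp_ann (affine_ann M v) (osum_ann (map net [0..<n]))) = [p, n * h, q]"
    using assms n_pos osum_ann_layer_carrier(1,2) is_ann_two_layer by simp_all
qed

lemma realize_comp_affine_osum_ann:
  assumes "M \<in> carrier_mat q m" "v \<in> carrier_vec q" "x \<in> carrier_vec p"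
  shows "realize a (comp_ann (affine_ann M v) (osum_ann (map net [0..<n]))) x
    = M *\<^sub>v vec m (\<lambda>i. \<Sum>k<n. realize a (net k) x $ i) + v"
  using assms osum_ann_layer_carrier(2-4)
  by (simp only: osum_ann_eq realize_comp_affine_ann_two_layer realize_osum_ann[symmetric])

end

section \<open>The networks \<open>\<bold>I\<^sub>\<gamma>\<close> and \<open>\<Psi>\<close>\<close>

definition sign_split_mat :: "real mat" where
  "sign_split_mat = mat 2 1 (\<lambda>(i, j). if i = 0 then 1 else -1)"

definition sign_split_bias :: "real \<Rightarrow> real vec" where
  "sign_split_bias t = vec 2 (\<lambda>i. if i = 0 then t else -t)"

definition sign_merge_mat :: "nat \<Rightarrow> real \<Rightarrow> real mat" where
  "sign_merge_mat \<gamma> r = mat 1 2 (\<lambda>(i, j). r * (if j = 0 then 1 else (-1) ^ \<gamma>))"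

definition scaled_shifted_I_ann :: "nat \<Rightarrow> real \<Rightarrow> real \<Rightarrow> ann" where
  "scaled_shifted_I_ann \<gamma> r t = [(sign_split_mat, sign_split_bias t), (sign_merge_mat \<gamma> r, 0\<^sub>v 1)]"

lemma I_ann_eq: "I_ann \<gamma> = scaled_shifted_I_ann \<gamma> 1 0"
  by (auto simp: I_ann_def scaled_shifted_I_ann_def sign_split_mat_def sign_split_bias_def
      sign_merge_mat_def intro!: eq_vecI)

lemma scal_ann_comp_I_ann:
  "scal_ann r (comp_ann (I_ann \<gamma>) (affine1 1 t)) = scaled_shifted_I_ann \<gamma> r t"
  unfolding scal_ann_def comp_ann_def affine_ann_def affine1_def I_ann_def ann_out_def
    scaled_shifted_I_ann_def sign_split_mat_def sign_split_bias_def sign_merge_mat_def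
  by (auto simp: scalar_prod_def intro!: eq_matI eq_vecI)

lemma is_ann_scaled_shifted_I_ann: "is_ann (scaled_shifted_I_ann \<gamma> r t)"
  unfolding scaled_shifted_I_ann_def by (rule is_ann_two_layer) (auto simp: sign_split_mat_def
    sign_split_bias_def sign_merge_mat_def)

lemma ann_dims_scaled_shifted_I_ann: "ann_dims (scaled_shifted_I_ann \<gamma> r t) = [1, 2, 1]"
  unfolding scaled_shifted_I_ann_def by (rule is_ann_two_layer) (auto simp: sign_split_mat_def
    sign_split_bias_def sign_merge_mat_def)

lemma realize_scaled_shifted_I_ann:
  "realize a (scaled_shifted_I_ann \<gamma> r t) (vec 1 (\<lambda>_. x))
    = vec 1 (\<lambda>_. r * (a (x + t) + (-1) ^ \<gamma> * a (- (x + t))))"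
  by (auto simp: scaled_shifted_I_ann_def sign_split_mat_def sign_split_bias_def sign_merge_mat_def
      scalar_prod_def numeral_2_eq_2 algebra_simps intro!: eq_vecI)

lemma is_ann_I_ann: "is_ann (I_ann \<gamma>)"
  by (simp add: I_ann_eq is_ann_scaled_shifted_I_ann)

lemma realize_I_ann:
  "realize a (I_ann \<gamma>) (vec 1 (\<lambda>_. x)) = vec 1 (\<lambda>_. a x + (-1) ^ \<gamma> * a (- x))"
  unfolding I_ann_eq realize_scaled_shifted_I_ann by simp

lemma is_ann_affine1: "is_ann (affine1 w t)"
  by (simp add: affine1_def affine_ann_def is_ann_def ann_dims_def)

lemma ann_in_I_ann_eq_ann_out_affine1: "ann_in (I_ann \<gamma>) = ann_out (affine1 w t)"
  by (simp add: I_ann_def ann_in_def ann_out_def affine1_def affine_ann_def)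

lemma Psi_ann_eq:
  "Psi_ann \<gamma> b c = comp_ann (affine1 1 (c ! 0))
     (osum_ann (map (\<lambda>k. scaled_shifted_I_ann \<gamma> (c ! Suc k) (b (Suc k))) [0..<\<gamma>]))"
proof -
  have "[1..<\<gamma> + 1] = map Suc [0..<\<gamma>]"
    by (simp add: map_Suc_upt)
  then show ?thesis
    unfolding Psi_ann_def scal_ann_comp_I_ann by (simp only: map_map o_def)
qed

lemma
  assumes "0 < \<gamma>"
  shows is_ann_Psi_ann: "is_ann (Psi_ann \<gamma> b c)"
    and ann_dims_Psi_ann: "ann_dims (Psi_ann \<gamma> b c) = [1, 2 * \<gamma>, 1]"
    and realize_Psi_ann: "realize a (Psi_ann \<gamma> b c) (vec 1 (\<lambda>_. x))
      = vec 1 (\<lambda>_. c ! 0 + (\<Sum>i = 1..\<gamma>. c ! i * (a (x + b i) + (-1) ^ \<gamma> * a (- (x + b i)))))"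
proof -
  interpret two_layer_family \<gamma> 1 2 1 "\<lambda>_. sign_split_mat" "\<lambda>k. sign_merge_mat \<gamma> (c ! Suc k)"
    "\<lambda>k. sign_split_bias (b (Suc k))" "\<lambda>_. 0\<^sub>v 1"
    using assms by unfold_locales (auto simp: sign_split_mat_def sign_merge_mat_def sign_split_bias_def)
  have Psi: "Psi_ann \<gamma> b c = comp_ann (affine_ann (mat 1 1 (\<lambda>_. 1)) (vec 1 (\<lambda>_. c ! 0)))
      (osum_ann (map net [0..<\<gamma>]))"
    by (simp add: Psi_ann_eq affine1_def scaled_shifted_I_ann_def)
  show "is_ann (Psi_ann \<gamma> b c)"
    unfolding Psi by (rule is_ann_comp_affine_osum_ann) auto
  have "ann_dims (Psi_ann \<gamma> b c) = [1, \<gamma> * 2, 1]"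
    unfolding Psi by (rule is_ann_comp_affine_osum_ann) auto
  then show "ann_dims (Psi_ann \<gamma> b c) = [1, 2 * \<gamma>, 1]"
    by (simp add: mult.commute)
  have "realize a (net k) (vec 1 (\<lambda>_. x)) $ 0
      = c ! Suc k * (a (x + b (Suc k)) + (-1) ^ \<gamma> * a (- (x + b (Suc k))))" for k
    using realize_scaled_shifted_I_ann[of a \<gamma> "c ! Suc k" "b (Suc k)" x]
    by (simp add: scaled_shifted_I_ann_def)
  then show "realize a (Psi_ann \<gamma> b c) (vec 1 (\<lambda>_. x))
      = vec 1 (\<lambda>_. c ! 0 + (\<Sum>i = 1..\<gamma>. c ! i * (a (x + b i) + (-1) ^ \<gamma> * a (- (x + b i)))))"
    unfolding Psi
    by (subst realize_comp_affine_osum_ann[of _ 1]) (auto simp: scalar_prod_def sum.atLeast1_atMost_eq)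
qed

section \<open>The coefficients \<open>c\<close>\<close>

lemma vandermonde_combination_eq_zero:
  fixes b d :: "'i \<Rightarrow> 'a :: idom"
  assumes I: "finite I" "inj_on b I" and j: "j \<in> I"
    and zero: "\<And>k. k < card I \<Longrightarrow> (\<Sum>i\<in>I. d i * b i ^ k) = 0"
  shows "d j = 0"
proof -
  define p where "p = (\<Prod>i\<in>I - {j}. [:- b i, 1:])"
  have "degree p \<le> card (I - {j})"
    unfolding p_def by (rule order.trans[OF degree_prod_sum_le]) (use I in auto)
  then have deg: "degree p < card I"
    using card_Diff1_less[OF I(1) j] by linarith
  have "poly p x = (\<Sum>k<card I. coeff p k * x ^ k)" for x
    unfolding poly_altdef using deg
    by (intro sum.mono_neutral_left) (auto simp: coeff_eq_0)
  then have "(\<Sum>i\<in>I. d i * poly p (b i)) = (\<Sum>k<card I. coeff p k * (\<Sum>i\<in>I. d i * b i ^ k))"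
    by (simp add: sum_distrib_left sum_distrib_right mult_ac sum.swap[of _ I])
  also have "\<dots> = 0"
    using zero by simp
  finally have "(\<Sum>i\<in>I. d i * poly p (b i)) = 0" .
  moreover have "(\<Sum>i\<in>I - {j}. d i * poly p (b i)) = 0"
    using I by (intro sum.neutral) (auto simp: p_def poly_prod intro!: prod_zero)
  ultimately have "d j * poly p (b j) = 0"
    using sum.remove[OF I(1) j, of "\<lambda>i. d i * poly p (b i)"] by simp
  moreover have "poly p (b j) \<noteq> 0"
    using I j by (auto simp: p_def poly_prod inj_on_eq_iff)
  ultimately show ?thesis
    by simp
qed

lemma vandermonde_system_solvable:
  fixes b :: "nat \<Rightarrow> 'a :: field"
  assumes "inj_on b {1..n}"
  shows "\<exists>d. \<forall>k<n. (\<Sum>i = 1..n. d i * b i ^ k) = r k"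
proof -
  define A where "A = mat n n (\<lambda>(k, i). b (Suc i) ^ k)"
  have A: "A \<in> carrier_mat n n"
    by (simp add: A_def)
  have A_mult: "(A *\<^sub>v v) $ k = (\<Sum>i = 1..n. v $ (i - 1) * b i ^ k)"
    if "k < n" "v \<in> carrier_vec n" for k v
    using that by (simp add: A_def scalar_prod_def sum.atLeast1_atMost_eq atLeast0LessThan mult.commute)
  have "det A \<noteq> 0"
  proof
    assume "det A = 0"
    then obtain v where v: "v \<in> carrier_vec n" "v \<noteq> 0\<^sub>v n" "A *\<^sub>v v = 0\<^sub>v n"
      using det_0_iff_vec_prod_zero[OF A] by auto
    have "(\<Sum>i = 1..n. v $ (i - 1) * b i ^ k) = 0" if "k < n" for k
      using A_mult[OF that v(1)] v(3) that by simp
    then have "v $ (i - 1) = 0" if "i \<in> {1..n}" for i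
      by (intro vandermonde_combination_eq_zero[OF finite_atLeastAtMost assms that,
            of "\<lambda>i. v $ (i - 1)"]) auto
    then have "v $ i = 0" if "i < n" for i
      using that by (metis Suc_leI atLeastAtMost_iff diff_Suc_1 le_add1 plus_1_eq_Suc)
    then have "v = 0\<^sub>v n"
      using v(1) by (intro eq_vecI) auto
    with v(2) show False ..
  qed
  then obtain B where B: "B \<in> carrier_mat n n" "A * B = 1\<^sub>m n"
    using det_non_zero_imp_unit[OF A] unfolding Units_def ring_mat_def by auto
  define s where "s = B *\<^sub>v vec n r"
  have s: "s \<in> carrier_vec n" "A *\<^sub>v s = vec n r"
    using A B by (auto simp: s_def assoc_mult_mat_vec[symmetric])
  show ?thesis
  proof (intro exI allI impI)
    fix k assume "k < n"
    then show "(\<Sum>i = 1..n. s $ (i - 1) * b i ^ k) = r k"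
      using A_mult[OF _ s(1), of k] s(2) by simp
  qed
qed

definition power_identity_coeffs :: "nat \<Rightarrow> (nat \<Rightarrow> real) \<Rightarrow> real list \<Rightarrow> bool" where
  "power_identity_coeffs \<gamma> b c \<longleftrightarrow> length c = \<gamma> + 1 \<and>
     (\<forall>k \<in> {0..\<gamma>}. (if k = \<gamma> then c ! 0 else 0) + (\<Sum>i = 1..\<gamma>. c ! i * b i ^ k)
                    = (if k = \<gamma> - 1 then 1 / real \<gamma> else 0))"

lemma power_identity_coeffsD:
  assumes "power_identity_coeffs \<gamma> b c" "k \<le> \<gamma>"
  shows "(if k = \<gamma> then c ! 0 else 0) + (\<Sum>i = 1..\<gamma>. c ! i * b i ^ k)
    = (if k = \<gamma> - 1 then 1 / real \<gamma> else 0)"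
  using assms by (simp add: power_identity_coeffs_def)

lemma ex1_power_identity_coeffs:
  assumes \<gamma>: "1 \<le> \<gamma>" and b: "inj_on b {1..\<gamma>}"
  shows "\<exists>!c. power_identity_coeffs \<gamma> b c"
proof (rule ex_ex1I)
  obtain d where d: "\<forall>k<\<gamma>. (\<Sum>i = 1..\<gamma>. d i * b i ^ k) = (if k = \<gamma> - 1 then 1 / real \<gamma> else 0)"
    using vandermonde_system_solvable[OF b, where r = "\<lambda>k. if k = \<gamma> - 1 then 1 / real \<gamma> else 0"]
    by blast
  define c where "c = - (\<Sum>i = 1..\<gamma>. d i * b i ^ \<gamma>) # map (\<lambda>i. d (Suc i)) [0..<\<gamma>]"
  have "c ! i = d i" if "i \<in> {1..\<gamma>}" for i
    using that by (cases i) (auto simp: c_def)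
  then have sums: "(\<Sum>i = 1..\<gamma>. c ! i * b i ^ k) = (\<Sum>i = 1..\<gamma>. d i * b i ^ k)" for k
    by (intro sum.cong) auto
  have c0: "c ! 0 = - (\<Sum>i = 1..\<gamma>. d i * b i ^ \<gamma>)"
    by (simp add: c_def)
  have "power_identity_coeffs \<gamma> b c"
    unfolding power_identity_coeffs_def
  proof (intro conjI ballI)
    show "length c = \<gamma> + 1"
      by (simp add: c_def)
    fix k assume "k \<in> {0..\<gamma>}"
    then consider "k = \<gamma>" | "k < \<gamma>"
      by fastforce
    then show "(if k = \<gamma> then c ! 0 else 0) + (\<Sum>i = 1..\<gamma>. c ! i * b i ^ k)
        = (if k = \<gamma> - 1 then 1 / real \<gamma> else 0)"
    proof cases
      case 1
      then show ?thesis
        using \<gamma> unfolding sums c0 by simp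
    next
      case 2
      then show ?thesis
        unfolding sums using d by simp
    qed
  qed
  then show "\<exists>c. power_identity_coeffs \<gamma> b c" ..
next
  fix c c' assume c: "power_identity_coeffs \<gamma> b c" and c': "power_identity_coeffs \<gamma> b c'"
  have "(\<Sum>i = 1..\<gamma>. (c ! i - c' ! i) * b i ^ k) = 0" if "k < \<gamma>" for k
    using power_identity_coeffsD[OF c, of k] power_identity_coeffsD[OF c', of k] that
    by (simp add: left_diff_distrib sum_subtractf)
  then have tail: "c ! i = c' ! i" if "i \<in> {1..\<gamma>}" for i
    using vandermonde_combination_eq_zero[OF finite_atLeastAtMost b that, of "\<lambda>i. c ! i - c' ! i"] by simp
  then have "(\<Sum>i = 1..\<gamma>. c ! i * b i ^ \<gamma>) = (\<Sum>i = 1..\<gamma>. c' ! i * b i ^ \<gamma>)"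
    by (intro sum.cong) auto
  then have "c ! 0 = c' ! 0"
    using power_identity_coeffsD[OF c, of \<gamma>] power_identity_coeffsD[OF c', of \<gamma>] by simp
  moreover have "length c = \<gamma> + 1" "length c' = \<gamma> + 1"
    using c c' by (simp_all add: power_identity_coeffs_def)
  ultimately show "c = c'"
    using tail by (intro nth_equalityI) (auto simp: less_Suc_eq_0_disj)
qed

lemma power_identity_coeffs_sum:
  assumes \<gamma>: "1 \<le> \<gamma>" and c: "power_identity_coeffs \<gamma> b c"
  shows "c ! 0 + (\<Sum>i = 1..\<gamma>. c ! i * (x + b i) ^ \<gamma>) = x"
proof -
  have moments: "(\<Sum>i = 1..\<gamma>. c ! i * b i ^ k)
      = (if k = \<gamma> - 1 then 1 / real \<gamma> else 0) - (if k = \<gamma> then c ! 0 else 0)" if "k \<le> \<gamma>" for k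
    using power_identity_coeffsD[OF c that] by (simp add: algebra_simps)
  have "(\<Sum>i = 1..\<gamma>. c ! i * (x + b i) ^ \<gamma>)
      = (\<Sum>i = 1..\<gamma>. c ! i * (\<Sum>k\<le>\<gamma>. of_nat (\<gamma> choose k) * b i ^ k * x ^ (\<gamma> - k)))"
    by (simp add: binomial_ring add.commute[of x])
  also have "\<dots> = (\<Sum>k\<le>\<gamma>. of_nat (\<gamma> choose k) * x ^ (\<gamma> - k) * (\<Sum>i = 1..\<gamma>. c ! i * b i ^ k))"
    by (simp add: sum_distrib_left sum_distrib_right mult_ac) (rule sum.swap)
  also have "\<dots> = (\<Sum>k\<le>\<gamma>. (if k = \<gamma> - 1 then of_nat (\<gamma> choose k) * x ^ (\<gamma> - k) / real \<gamma> else 0)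
      - (if k = \<gamma> then c ! 0 else 0))"
  proof (intro sum.cong refl)
    fix k assume "k \<in> {..\<gamma>}"
    then show "of_nat (\<gamma> choose k) * x ^ (\<gamma> - k) * (\<Sum>i = 1..\<gamma>. c ! i * b i ^ k)
        = (if k = \<gamma> - 1 then of_nat (\<gamma> choose k) * x ^ (\<gamma> - k) / real \<gamma> else 0)
          - (if k = \<gamma> then c ! 0 else 0)"
      using \<gamma> by (subst moments) auto
  qed
  also have "\<dots> = x - c ! 0"
    using \<gamma> binomial_symmetric[of 1 \<gamma>] by (simp add: sum_subtractf)
  finally show ?thesis
    by simp
qed

lemma power_split_max_0:
  fixes y :: real
  assumes "1 \<le> g"
  shows "max y 0 ^ g + (-1) ^ g * max (- y) 0 ^ g = y ^ g"
proof (cases "0 \<le> y")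
  case False
  then have "(-1) ^ g * (- y) ^ g = y ^ g"
    by (simp flip: power_mult_distrib)
  with False assms show ?thesis
    by (simp add: max_def)
qed (use assms in \<open>simp add: max_def\<close>)

theorem mainTheorem10:
  fixes \<gamma> :: nat and b :: "nat \<Rightarrow> real" and a :: "real \<Rightarrow> real"
  assumes "\<gamma> \<ge> 1" and "\<gamma> \<noteq> 1"
    and "\<And>i j. 1 \<le> i \<Longrightarrow> i < j \<Longrightarrow> j \<le> \<gamma> \<Longrightarrow> b i < b j"
    and "continuous_on UNIV a"
    and "\<And>x. a x = (max x 0) ^ \<gamma>"
  shows "(\<forall>x. realize a (I_ann \<gamma>) (vec 1 (\<lambda>_. x)) = vec 1 (\<lambda>_. x ^ \<gamma>))
    \<and> (\<exists>!c :: real list. length c = \<gamma> + 1 \<and>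
          (\<forall>k \<in> {0..\<gamma>}. (if k = \<gamma> then c ! 0 else 0) + (\<Sum>i = 1..\<gamma>. c ! i * b i ^ k)
                        = (if k = \<gamma> - 1 then 1 / real \<gamma> else 0)))
    \<and> (\<forall>c :: real list. length c = \<gamma> + 1 \<and>
          (\<forall>k \<in> {0..\<gamma>}. (if k = \<gamma> then c ! 0 else 0) + (\<Sum>i = 1..\<gamma>. c ! i * b i ^ k)
                        = (if k = \<gamma> - 1 then 1 / real \<gamma> else 0)) \<longrightarrow>
        (\<forall>i \<in> {1..\<gamma>}. is_ann (I_ann \<gamma>) \<and> is_ann (affine1 1 (b i))
              \<and> ann_in (I_ann \<gamma>) = ann_out (affine1 1 (b i))
              \<and> is_ann (scal_ann (c ! i) (comp_ann (I_ann \<gamma>) (affine1 1 (b i))))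
              \<and> ann_dims (scal_ann (c ! i) (comp_ann (I_ann \<gamma>) (affine1 1 (b i)))) = [1, 2, 1])
        \<and> is_ann (Psi_ann \<gamma> b c)
        \<and> ann_dims (Psi_ann \<gamma> b c) = [1, 2 * \<gamma>, 1]
        \<and> continuous_on UNIV (\<lambda>x. realize a (Psi_ann \<gamma> b c) (vec 1 (\<lambda>_. x)) $ 0)
        \<and> (\<forall>x. realize a (Psi_ann \<gamma> b c) (vec 1 (\<lambda>_. x)) = vec 1 (\<lambda>_. x)))"
proof -
  have \<gamma>: "0 < \<gamma>"
    using assms(1) by simp
  have b: "inj_on b {1..\<gamma>}"
    using assms(3) by (intro strict_mono_on_imp_inj_on strict_mono_onI) auto
  have a: "a y + (-1) ^ \<gamma> * a (- y) = y ^ \<gamma>" for y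
    using assms(1) by (simp add: assms(5) power_split_max_0)
  have I: "realize a (I_ann \<gamma>) (vec 1 (\<lambda>_. x)) = vec 1 (\<lambda>_. x ^ \<gamma>)" for x
    unfolding realize_I_ann a ..
  have Psi: "(\<forall>x. realize a (Psi_ann \<gamma> b c) (vec 1 (\<lambda>_. x)) = vec 1 (\<lambda>_. x))
      \<and> continuous_on UNIV (\<lambda>x. realize a (Psi_ann \<gamma> b c) (vec 1 (\<lambda>_. x)) $ 0)"
    if "power_identity_coeffs \<gamma> b c" for c
    using assms(1) \<gamma> that continuous_on_id
    by (simp only: realize_Psi_ann a power_identity_coeffs_sum) simp
  show ?thesis
    unfolding power_identity_coeffs_def[symmetric]
    using I ex1_power_identity_coeffs[OF assms(1) b] Psi
    by (simp add: is_ann_I_ann is_ann_affine1 ann_in_I_ann_eq_ann_out_affine1 scal_ann_comp_I_ann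
        is_ann_scaled_shifted_I_ann ann_dims_scaled_shifted_I_ann
        is_ann_Psi_ann[OF \<gamma>] ann_dims_Psi_ann[OF \<gamma>])
qed

end
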